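(* Let $\mathcal{B}$ be the collection of bases of a symplectic matroid on $E_{\pm n}$, and let $\mathcal{C}$ be the collection of minimal admissible subsets of $E_{\pm n}$ not contained in any member of $\mathcal{B}$. Let $P$ be an admissible subset of $E_{\pm n}$ and $B\in\mathcal{B}$. If $|P|<|B|$, then $P$ does not span $E_{\pm n}-(P\cup P^* )$, i.e. there exists $x\in E_{\pm n}-(P\cup P^* )$ that $P$ does not span.
   Context: Let $E_{\pm n}=[n]\cup[n]^*$ where $[n]^*=\{1^*,\dots,n^*\}$ and $*$ is the involution $i\leftrightarrow i^*$; $S^*=\{s^*:s\in S\}$. A set $S$ is admissible if $S\cap S^*=\emptyset$. A linear ordering $<$ on $E_{\pm n}$ is admissible if $i<j$ implies $j^*<i^*$. For admissible $k$-sets $A=\{a_1<\dots<a_k\}$, $B=\{b_1<\dots<b_k\}$ set $A\le B$ iff $a_i\le b_i$ for all $i$. A symplectic matroid is a pair $(E_{\pm n};\mathcal{B})$ with $\mathcal{B}$ a non-empty family of equi-numerous admissible subsets of $E_{\pm n}$ such that for every admissible ordering, $\mathcal{B}$ has a unique maximal element in the induced order. An admissible set $P$ spans $x\in E_{\pm n}$ (with respect to $\mathcal{C}$) if there exists $J\in\mathcal{C}$ with $J-P=\{x\}$. *)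

theory Defs
  imports Main
begin

text \<open>\<open>Plain i\<close> stands for \<open>i\<close> and \<open>Starred i\<close> for \<open>i\<^sup>*\<close>.\<close>

datatype signed = Plain nat | Starred nat

fun star :: "signed \<Rightarrow> signed" where
  "star (Plain i) = Starred i"
| "star (Starred i) = Plain i"

lemma star_star [simp]: "star (star x) = x"
  by (cases x) simp_all

definition ground :: "nat \<Rightarrow> signed set" where
  "ground n = Plain ` {1..n} \<union> Starred ` {1..n}"

definition admissible :: "nat \<Rightarrow> signed set \<Rightarrow> bool" where
  "admissible n S \<longleftrightarrow> S \<subseteq> ground n \<and> S \<inter> star ` S = {}"

text \<open>Linear orderings are reflexive relations, as in the library; the strict ordering \<open><\<close> is
  \<open>r - Id\<close>.\<close>

definition admissible_order :: "nat \<Rightarrow> signed rel \<Rightarrow> bool" where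
  "admissible_order n r \<longleftrightarrow> linear_order_on (ground n) r \<and>
     (\<forall>i j. (i, j) \<in> r - Id \<longrightarrow> (star j, star i) \<in> r - Id)"

text \<open>\<open>xs\<close> and \<open>ys\<close> are the increasing enumerations \<open>a\<^sub>1 < \<dots> < a\<^sub>k\<close> and
  \<open>b\<^sub>1 < \<dots> < b\<^sub>k\<close> of the two sets; \<^const>\<open>list_all2\<close> forces them to have equal length.\<close>

definition induced_le :: "signed rel \<Rightarrow> signed set \<Rightarrow> signed set \<Rightarrow> bool" where
  "induced_le r A B \<longleftrightarrow> (\<exists>xs ys.
     set xs = A \<and> sorted_wrt (\<lambda>x y. (x, y) \<in> r - Id) xs \<and>
     set ys = B \<and> sorted_wrt (\<lambda>x y. (x, y) \<in> r - Id) ys \<and>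
     list_all2 (\<lambda>x y. (x, y) \<in> r) xs ys)"

definition symplectic_matroid :: "nat \<Rightarrow> signed set set \<Rightarrow> bool" where
  "symplectic_matroid n \<B> \<longleftrightarrow>
     \<B> \<noteq> {} \<and>
     (\<forall>B\<in>\<B>. admissible n B) \<and>
     (\<forall>A\<in>\<B>. \<forall>B\<in>\<B>. card A = card B) \<and>
     (\<forall>r. admissible_order n r \<longrightarrow>
        (\<exists>!M. M \<in> \<B> \<and> (\<forall>B\<in>\<B>. induced_le r M B \<longrightarrow> B = M)))"

definition dependents :: "nat \<Rightarrow> signed set set \<Rightarrow> signed set set" where
  "dependents n \<B> = {J. admissible n J \<and> \<not> (\<exists>B\<in>\<B>. J \<subseteq> B)}"

definition circuits :: "nat \<Rightarrow> signed set set \<Rightarrow> signed set set" where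
  "circuits n \<B> = {J \<in> dependents n \<B>. \<forall>K \<in> dependents n \<B>. K \<subseteq> J \<longrightarrow> K = J}"

definition spans :: "signed set set \<Rightarrow> signed set \<Rightarrow> signed \<Rightarrow> bool" where
  "spans \<C> P x \<longleftrightarrow> (\<exists>J\<in>\<C>. J - P = {x})"

end

theory Submission
  imports Defs
begin

text \<open>Assume that \<open>P\<close> spans every \<open>x \<notin> P \<union> P\<^sup>*\<close>, and let \<open>M\<close> be a basis meeting \<open>P\<close> in as many
  elements as possible. An admissible set inside \<open>P \<union> P\<^sup>*\<close> has at most \<open>|P|\<close> elements, so \<open>M\<close>
  contains some \<open>x \<notin> P \<union> P\<^sup>*\<close>; take a circuit \<open>J\<close> with \<open>J - P = {x}\<close>. Under an admissible ordering
  with \<open>J - {x}\<close> on top, followed by the rest of \<open>P\<close>, then \<open>x\<close>, then everything else, the maximal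
  basis \<open>N\<close> meets every upper set in at least as many elements as any other basis. It therefore
  contains the independent set \<open>J - {x}\<close>, and it meets \<open>P \<union> {x}\<close> in more elements than \<open>M\<close> meets
  \<open>P\<close>, so it contains \<open>x\<close> by the choice of \<open>M\<close>. Hence \<open>J \<subseteq> N\<close>, a contradiction.\<close>

section \<open>Admissible sets under the star involution\<close>

lemma finite_ground [simp]: "finite (ground n)"
  by (simp add: ground_def)

lemma star_in_ground [simp]: "star x \<in> ground n \<longleftrightarrow> x \<in> ground n"
  by (cases x) (auto simp: ground_def)

lemma inj_star: "inj star"
  by (metis injI star_star)

lemma in_star_image_iff: "y \<in> star ` P \<longleftrightarrow> star y \<in> P"
  by (metis imageE image_eqI star_star)

lemma admissible_finite: "admissible n S \<Longrightarrow> finite S"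
  unfolding admissible_def by (meson finite_ground finite_subset)

lemma admissible_star_notin: "admissible n S \<Longrightarrow> y \<in> S \<Longrightarrow> star y \<notin> S"
  unfolding admissible_def by (metis disjoint_iff image_eqI star_star)

lemma symplectic_admissible: "symplectic_matroid n \<B> \<Longrightarrow> A \<in> \<B> \<Longrightarrow> admissible n A"
  by (simp add: symplectic_matroid_def)

text \<open>Replacing each element outside \<open>P\<close> by its star is injective on
  \<open>M\<close>, since \<open>M\<close> contains no element together with its star.\<close>

lemma card_admissible_le:
  assumes "admissible n M" "M \<subseteq> P \<union> star ` P" "finite P"
  shows "card M \<le> card P"
proof (rule card_inj_on_le)
  let ?g = "\<lambda>y. if y \<in> P then y else star y"
  show "inj_on ?g M"
    using admissible_star_notin[OF assms(1)]
    by (auto intro!: inj_onI split: if_splits) (metis star_star)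
  show "?g ` M \<subseteq> P"
    using assms(2) by (auto simp: in_star_image_iff)
qed fact

section \<open>Orderings given by odd integer weights\<close>

definition weight_order :: "nat \<Rightarrow> (signed \<Rightarrow> int) \<Rightarrow> signed rel" where
  "weight_order n f = {(x, y). x \<in> ground n \<and> y \<in> ground n \<and> f x \<le> f y}"

text \<open>Injectivity gives antisymmetry; oddness makes \<open>star\<close> reverse the
  order.\<close>

lemma admissible_weight_order:
  assumes "inj_on f (ground n)" "\<And>x. f (star x) = - f x"
  shows "admissible_order n (weight_order n f)"
proof -
  have "antisym (weight_order n f)"
    using assms(1) by (auto simp: weight_order_def antisym_def inj_on_def)
  then have "linear_order_on (ground n) (weight_order n f)"
    by (auto simp: linear_order_on_def partial_order_on_def preorder_on_def refl_on_def
        trans_def total_on_def weight_order_def)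
  then show ?thesis
    by (auto simp: admissible_order_def weight_order_def assms(2) dest: injD[OF inj_star])
qed

lemma sorted_weight_order_distinct:
  "sorted_wrt (\<lambda>x y. (x, y) \<in> weight_order n f - Id) xs \<Longrightarrow> distinct xs"
  by (induction xs) auto

text \<open>Each entry of \<open>xs\<close> with weight at least \<open>t\<close> is matched with
  such an entry of \<open>ys\<close>.\<close>

lemma induced_le_card_upper:
  assumes "induced_le (weight_order n f) A B"
  shows "card {a \<in> A. t \<le> f a} \<le> card {b \<in> B. t \<le> f b}"
proof -
  obtain xs ys where xs: "set xs = A" "distinct xs" and ys: "set ys = B" "distinct ys"
    and le: "list_all2 (\<lambda>x y. (x, y) \<in> weight_order n f) xs ys"
    using assms sorted_weight_order_distinct unfolding induced_le_def by blast
  have "length (filter (\<lambda>a. t \<le> f a) xs) \<le> length (filter (\<lambda>a. t \<le> f a) ys)"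
    using le by (induction rule: list_all2_induct) (auto simp: weight_order_def)
  then have "card (set (filter (\<lambda>a. t \<le> f a) xs)) \<le> card (set (filter (\<lambda>a. t \<le> f a) ys))"
    using xs(2) ys(2) by (simp add: distinct_card del: set_filter)
  then show ?thesis
    using xs(1) ys(1) by simp
qed

text \<open>Weights rise entrywise, and injectivity turns equal totals into equal entries.
  Maximizing the total therefore yields maximal sets.\<close>

lemma induced_le_sum:
  assumes "induced_le (weight_order n f) A B" "inj_on f (ground n)"
  shows "sum f A \<le> sum f B" and "sum f A = sum f B \<Longrightarrow> A = B"
proof -
  obtain xs ys where xs: "set xs = A" "distinct xs" and ys: "set ys = B" "distinct ys"
    and le: "list_all2 (\<lambda>x y. (x, y) \<in> weight_order n f) xs ys"
    using assms(1) sorted_weight_order_distinct unfolding induced_le_def by blast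
  have sums: "sum f A = sum_list (map f xs)" "sum f B = sum_list (map f ys)"
    using xs ys by (auto simp: sum_list_distinct_conv_sum_set)
  have "sum_list (map f xs) \<le> sum_list (map f ys) \<and>
      (sum_list (map f xs) = sum_list (map f ys) \<longrightarrow> xs = ys)"
    using le
  proof (induction rule: list_all2_induct)
    case (Cons x xs y ys)
    then show ?case
      using inj_onD[OF assms(2), of x y] by (auto simp: weight_order_def)
  qed simp
  then show "sum f A \<le> sum f B" and "sum f A = sum f B \<Longrightarrow> A = B"
    using sums xs ys by auto
qed

section \<open>Bases maximal on every upper set\<close>

text \<open>For each \<open>t\<close>, a basis with lexicographically largest (number of elements of weight at least
  \<open>t\<close>, total weight) is maximal in the induced order, hence equal to the unique maximal basis.\<close>

lemma ex_basis_max_upper_inj: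
  fixes f :: "signed \<Rightarrow> int"
  assumes "symplectic_matroid n \<B>" "inj_on f (ground n)" "\<And>x. f (star x) = - f x"
  shows "\<exists>M\<in>\<B>. \<forall>A\<in>\<B>. \<forall>t. card {a \<in> A. t \<le> f a} \<le> card {a \<in> M. t \<le> f a}"
proof -
  let ?r = "weight_order n f"
  have "\<B> \<subseteq> Pow (ground n)"
    using symplectic_admissible[OF assms(1)] by (auto simp: admissible_def)
  then have fin: "finite \<B>"
    by (meson finite_Pow_iff finite_ground finite_subset)
  have "\<exists>!M. M \<in> \<B> \<and> (\<forall>B\<in>\<B>. induced_le ?r M B \<longrightarrow> B = M)"
    using assms(1) admissible_weight_order[OF assms(2,3)] unfolding symplectic_matroid_def by blast
  then obtain M where M: "M \<in> \<B>"
    and uniq: "\<And>C. C \<in> \<B> \<and> (\<forall>D\<in>\<B>. induced_le ?r C D \<longrightarrow> D = C) \<Longrightarrow> C = M"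
    unfolding Ex1_def by blast
  have "card {a \<in> A. t \<le> f a} \<le> card {a \<in> M. t \<le> f a}" if A: "A \<in> \<B>" for A t
  proof -
    let ?c = "\<lambda>C. card {a \<in> C. t \<le> f a}"
    define S where "S = {C \<in> \<B>. ?c C = Max (?c ` \<B>)}"
    have le: "?c C \<le> Max (?c ` \<B>)" if "C \<in> \<B>" for C
      using fin that by simp
    have "Max (?c ` \<B>) \<in> ?c ` \<B>"
      using fin A by (intro Max_in) auto
    then have S: "S \<noteq> {}" "finite S"
      using fin by (auto simp: S_def)
    then have "Max (sum f ` S) \<in> sum f ` S"
      by (intro Max_in) auto
    then obtain C where C: "C \<in> S" "sum f C = Max (sum f ` S)"
      by auto
    have "C = M"
    proof (rule uniq, intro conjI ballI impI)
      show "C \<in> \<B>" using C by (simp add: S_def)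
      fix D assume D: "D \<in> \<B>" "induced_le ?r C D"
      then have "?c C \<le> ?c D"
        by (intro induced_le_card_upper)
      then have "D \<in> S"
        using C(1) D(1) le[OF D(1)] by (auto simp: S_def)
      then have "sum f D \<le> sum f C"
        using S C by simp
      then show "D = C"
        using induced_le_sum[OF D(2) assms(2)] by force
    qed
    then show ?thesis
      using C(1) le[OF A] by (simp add: S_def)
  qed
  then show ?thesis
    using M by blast
qed

text \<open>For fixed \<open>d\<close> the values form a block of \<open>2 * N + 1\<close> integers;
  distinct blocks are disjoint, and \<open>(2 * N + 1) * t - N\<close> is the least element of block
  \<open>t\<close>.\<close>

lemma block_le_iff:
  fixes t d v N :: int
  assumes "\<bar>v\<bar> \<le> N"
  shows "(2 * N + 1) * t - N \<le> (2 * N + 1) * d + v \<longleftrightarrow> t \<le> d"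
proof
  assume "t \<le> d"
  then have "(2 * N + 1) * t \<le> (2 * N + 1) * d"
    using assms by (intro mult_left_mono) auto
  then show "(2 * N + 1) * t - N \<le> (2 * N + 1) * d + v"
    using assms by linarith
next
  assume *: "(2 * N + 1) * t - N \<le> (2 * N + 1) * d + v"
  show "t \<le> d"
  proof (rule ccontr)
    assume "\<not> t \<le> d"
    then have "(2 * N + 1) * (d + 1) \<le> (2 * N + 1) * t"
      using assms by (intro mult_left_mono) auto
    then show False
      using * assms by (simp add: algebra_simps)
  qed
qed

text \<open>Ties of \<open>d\<close> are broken by scaling \<open>d\<close> and adding the signed index, which is odd as well.\<close>

lemma ex_basis_max_upper:
  fixes d :: "signed \<Rightarrow> int"
  assumes "symplectic_matroid n \<B>" "\<And>x. d (star x) = - d x"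
  shows "\<exists>M\<in>\<B>. \<forall>A\<in>\<B>. \<forall>t. card {a \<in> A. t \<le> d a} \<le> card {a \<in> M. t \<le> d a}"
proof -
  define v where "v = (\<lambda>y. case y of Plain i \<Rightarrow> int i | Starred i \<Rightarrow> - int i)"
  define f where "f = (\<lambda>y. (2 * int n + 1) * d y + v y)"
  have v_star: "v (star y) = - v y" for y
    by (cases y) (auto simp: v_def)
  have v_le: "\<bar>v y\<bar> \<le> int n" if "y \<in> ground n" for y
    using that by (auto simp: v_def ground_def)
  have block: "(2 * int n + 1) * t - int n \<le> f y \<longleftrightarrow> t \<le> d y" if "y \<in> ground n" for y t
    unfolding f_def by (rule block_le_iff[OF v_le[OF that]])
  have "inj_on f (ground n)"
  proof (rule inj_onI)
    fix x y assume xy: "x \<in> ground n" "y \<in> ground n" "f x = f y"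
    \<comment> \<open>With thresholds \<open>t = d x\<close> and \<open>t = d y\<close>, equality of
      \<open>f\<close> bounds \<open>d x\<close> and \<open>d y\<close> by each other.\<close>
    have "d x = d y"
      using block[OF xy(1)] block[OF xy(2)] xy(3) by (metis order.antisym order.refl)
    then have "v x = v y"
      using xy(3) by (simp add: f_def)
    then show "x = y"
      using xy(1,2) by (auto simp: v_def ground_def)
  qed
  moreover have "f (star x) = - f x" for x
    by (simp add: f_def assms(2) v_star)
  ultimately obtain M where M: "M \<in> \<B>"
    "\<forall>A\<in>\<B>. \<forall>t. card {a \<in> A. t \<le> f a} \<le> card {a \<in> M. t \<le> f a}"
    using ex_basis_max_upper_inj[OF assms(1)] by blast
  have level: "{a \<in> A. (2 * int n + 1) * t - int n \<le> f a} = {a \<in> A. t \<le> d a}" if "A \<in> \<B>" for A t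
    using block symplectic_admissible[OF assms(1) that] by (auto simp: admissible_def)
  have "card {a \<in> A. t \<le> d a} \<le> card {a \<in> M. t \<le> d a}" if "A \<in> \<B>" for A t
    using M(2)[rule_format, OF that, of "(2 * int n + 1) * t - int n"]
    unfolding level[OF that] level[OF M(1)] .
  then show ?thesis
    using M(1) by blast
qed

section \<open>Failure of spanning below the rank\<close>

theorem theorem2:
  fixes n :: nat and \<B> :: "signed set set" and P B :: "signed set"
  assumes "symplectic_matroid n \<B>"
    and "admissible n P"
    and "B \<in> \<B>"
    and "card P < card B"
  shows "\<exists>x \<in> ground n - (P \<union> star ` P). \<not> spans (circuits n \<B>) P x"
proof (rule ccontr)
  assume "\<not> ?thesis"
  then have spanned: "\<And>x. x \<in> ground n - (P \<union> star ` P) \<Longrightarrow> spans (circuits n \<B>) P x"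
    by blast
  have finP: "finite P"
    using assms(2) by (rule admissible_finite)
  have adm: "admissible n A" if "A \<in> \<B>" for A
    using assms(1) that by (rule symplectic_admissible)
  have "\<forall>A. A \<in> \<B> \<longrightarrow> card (A \<inter> P) < Suc (card P)"
    using finP by (auto simp: less_Suc_eq_le intro: card_mono)
  then obtain M where M: "M \<in> \<B>" and max: "\<And>A. A \<in> \<B> \<Longrightarrow> card (A \<inter> P) \<le> card (M \<inter> P)"
    using ex_has_greatest_nat[of "\<lambda>A. A \<in> \<B>" B "\<lambda>A. card (A \<inter> P)" "Suc (card P)"] assms(3) by blast
  have "card P < card M"
    using assms(1,3,4) M unfolding symplectic_matroid_def by metis
  then obtain x where x: "x \<in> M" "x \<notin> P" "x \<notin> star ` P"
    using card_admissible_le[OF adm[OF M] _ finP] by (meson UnI1 UnI2 linorder_not_le subsetI)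
  then have "x \<in> ground n - (P \<union> star ` P)"
    using adm[OF M] by (auto simp: admissible_def)
  then obtain J where J: "J \<in> circuits n \<B>" "J - P = {x}"
    using spanned unfolding spans_def by meson
  define I where "I = J - {x}"
  have IP: "I \<subseteq> P"
    using J(2) by (auto simp: I_def)
  have admJ: "admissible n J" and depJ: "\<And>A. A \<in> \<B> \<Longrightarrow> \<not> J \<subseteq> A"
    and minJ: "\<And>K. K \<in> dependents n \<B> \<Longrightarrow> K \<subseteq> J \<Longrightarrow> K = J"
    using J(1) by (simp_all add: circuits_def dependents_def)
  have "I \<noteq> J" "I \<subseteq> J"
    using J(2) by (auto simp: I_def)
  moreover from this have "admissible n I"
    using admJ unfolding admissible_def by blast
  \<comment> \<open>By minimality of the circuit \<open>J\<close>, its proper subset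
    \<open>I\<close> is independent.\<close>
  ultimately obtain B0 where B0: "B0 \<in> \<B>" "I \<subseteq> B0"
    using minJ[of I] unfolding dependents_def by blast
  \<comment> \<open>The values 3, 2, 1 make \<open>I\<close>, \<open>P\<close> and
    \<open>insert x P\<close> nested upper sets of \<open>d\<close>. Subtracting
    \<open>c (star y)\<close> makes \<open>d\<close> odd and changes nothing on
    \<open>insert x P\<close>, where that term is 0.\<close>
  define c :: "signed \<Rightarrow> int"
    where "c = (\<lambda>y. if y \<in> I then 3 else if y \<in> P then 2 else if y = x then 1 else 0)"
  define d where "d = (\<lambda>y. c y - c (star y))"
  have d_star: "d (star y) = - d y" for y
    by (simp add: d_def)
  have nstar: "star y \<notin> P \<and> star y \<noteq> x" if "y \<in> P" for y
    using admissible_star_notin[OF assms(2) that] x(3) that by (auto simp: in_star_image_iff)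
  have c_star: "c (star y) = 0" if "y \<in> insert x P" for y
  proof (cases "y = x")
    case True
    have "star x \<noteq> x" by (cases x) auto
    then show ?thesis
      using True x(3) IP by (auto simp: c_def in_star_image_iff)
  qed (use nstar IP that in \<open>auto simp: c_def\<close>)
  have d_upper: "3 \<le> d y \<longleftrightarrow> y \<in> I" "2 \<le> d y \<longleftrightarrow> y \<in> P" "1 \<le> d y \<longleftrightarrow> y \<in> insert x P" for y
  proof -
    have "d y = c y" if "y \<in> insert x P"
      using c_star[OF that] by (simp add: d_def)
    moreover have "d y \<le> 0" if "y \<notin> insert x P"
      using that IP by (auto simp: d_def c_def)
    ultimately show "3 \<le> d y \<longleftrightarrow> y \<in> I" "2 \<le> d y \<longleftrightarrow> y \<in> P" "1 \<le> d y \<longleftrightarrow> y \<in> insert x P"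
      using IP x(2) by (cases "y \<in> insert x P"; auto simp: c_def split: if_splits)+
  qed
  obtain N where N: "N \<in> \<B>"
    and top: "\<And>A t. A \<in> \<B> \<Longrightarrow> card {a \<in> A. t \<le> d a} \<le> card {a \<in> N. t \<le> d a}"
    using ex_basis_max_upper[where d = d, OF assms(1) d_star] by blast
  \<comment> \<open>\<open>B0 \<inter> I\<close> is all of \<open>I\<close>, so no element of
    \<open>I\<close> can be missing from \<open>N\<close>.\<close>
  have "card (B0 \<inter> I) \<le> card (N \<inter> I)"
    using top[OF B0(1), of 3] by (simp add: d_upper Int_def)
  then have "I \<subseteq> N"
    using B0(2) finite_subset[OF IP finP]
    by (metis card_seteq inf.absorb_iff2 inf_le2)
  moreover have "x \<in> N"
  proof (rule ccontr)
    assume "x \<notin> N"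
    \<comment> \<open>Passing from \<open>P\<close> to \<open>insert x P\<close> gains
      \<open>x\<close> for \<open>M\<close> but nothing for \<open>N\<close>, so \<open>N\<close>
      would meet \<open>P\<close> in more elements than \<open>M\<close> does.\<close>
    have "card (M \<inter> insert x P) \<le> card (N \<inter> insert x P)"
      using top[OF M, of 1] by (simp only: d_upper Int_def)
    also have "N \<inter> insert x P = N \<inter> P"
      using \<open>x \<notin> N\<close> by auto
    also have "card (N \<inter> P) \<le> card (M \<inter> P)"
      by (rule max[OF N])
    finally show False
      using x(1,2) finP by simp
  qed
  ultimately have "J \<subseteq> N"
    by (auto simp: I_def)
  then show False
    using depJ[OF N] by simp
qed

end
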